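(* Let $\phi:\mathbb{R}\to\mathbb{R}$ be a generalized sampling kernel satisfying $\sum_{n\in\mathbb{Z}}\phi(t-n)=1$ for all $t\in[0,1)$. Then: (i) $\phi$ exhibits a left Gibbs--Wilbraham phenomenon if and only if there exists $y<0$ such that $\sum_{n\ge 0}\phi(y-n)<0$. (ii) $\phi$ exhibits a right Gibbs--Wilbraham phenomenon if and only if there exists $x>0$ such that $\sum_{n<0}\phi(x-n)<0$. (iii) $\phi$ exhibits a strong Gibbs--Wilbraham phenomenon if and only if there exist $y<0$ and $x>0$ such that $\sum_{n\ge 0}\phi(y-n)<0$ and $\sum_{n<0}\phi(x-n)<0$.
   Context: Sums over $n\ge 0$ and $n<0$ are over integers $n$. A generalized sampling kernel is a continuous function $\phi:\mathbb{R}\to\mathbb{R}$ such that the series $\sum_{n\in\mathbb{Z}}|\phi(t-n)|$ converges uniformly on $[0,1]$. For such $\phi$, by a theorem of Butzer, Ries and Stens, the condition $\sum_{n\in\mathbb{Z}}\phi(t-n)=1$ for $t\in[0,1)$ is equivalent to: for every bounded $f:\mathbb{R}\to\mathbb{R}$, $\lim_{W\to\infty}\sum_{n\in\mathbb{Z}}f(n/W)\phi(Wt-n)=f(t)$ at every point $t$ of continuity of $f$. Write $f(0-)=\lim_{x\to0^-}f(x)$ and $f(0+)=\lim_{x\to0^+}f(x)$. Admissible functions are the bounded functions $f:\mathbb{R}\to\mathbb{R}$ with a jump discontinuity at $0$ (both one-sided limits exist, are finite, and $f(0-)\neq f(0+)$) and $f(0)=f(0+)$. For admissible $f$, the Gibbs--Wilbraham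 function is $$G_\phi[f](t)=f(0+)\sum_{n\ge0}\phi(t-n)+f(0-)\sum_{n<0}\phi(t-n),\quad t\in\mathbb{R}.$$ Let $\phi$ be a generalized sampling kernel with $\sum_{n\in\mathbb{Z}}\phi(t-n)=1$ for $t\in[0,1)$, and let $f$ be admissible. - If $f(0-)<f(0+)$, then $\phi$ exhibits a left (resp. right) Gibbs--Wilbraham phenomenon for $f$ if there exists $y<0$ with $G_\phi[f](y)<f(0-)$ (resp. there exists $x>0$ with $G_\phi[f](x)>f(0+)$). - If $f(0-)>f(0+)$, then $\phi$ exhibits a left (resp. right) Gibbs--Wilbraham phenomenon for $f$ if it does so for $-f$. - $\phi$ exhibits a strong Gibbs--Wilbraham phenomenon for $f$ if it exhibits both a left and a right one for $f$. - $\phi$ exhibits a left (resp. right, resp. strong) Gibbs--Wilbraham phenomenon if it exhibits a left (resp. right, resp. strong) one for every admissible $f$. *)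

theory Defs
  imports "HOL-Analysis.Analysis"
begin

text \<open>Since the terms are nonnegative, uniform convergence of the symmetric partial sums is the
  same as uniform convergence of the two-sided series under any other reading.\<close>

definition generalized_sampling_kernel :: "(real \<Rightarrow> real) \<Rightarrow> bool" where
  "generalized_sampling_kernel \<phi> \<longleftrightarrow>
     continuous_on UNIV \<phi> \<and>
     uniformly_convergent_on {0..1} (\<lambda>N t. \<Sum>n\<in>{- int N..int N}. \<bar>\<phi> (t - of_int n)\<bar>)"

definition left_value :: "(real \<Rightarrow> real) \<Rightarrow> real" where
  "left_value f = Lim (at_left 0) f"

definition right_value :: "(real \<Rightarrow> real) \<Rightarrow> real" where
  "right_value f = Lim (at_right 0) f"

definition admissible :: "(real \<Rightarrow> real) \<Rightarrow> bool" where
  "admissible f \<longleftrightarrow>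
     bounded (range f) \<and>
     (\<exists>l. (f \<longlongrightarrow> l) (at_left 0)) \<and> (\<exists>r. (f \<longlongrightarrow> r) (at_right 0)) \<and>
     left_value f \<noteq> right_value f \<and> f 0 = right_value f"

definition gibbs_fun :: "(real \<Rightarrow> real) \<Rightarrow> (real \<Rightarrow> real) \<Rightarrow> real \<Rightarrow> real" where
  "gibbs_fun \<phi> f t =
     right_value f * (\<Sum>\<^sub>\<infinity>n\<in>{0::int..}. \<phi> (t - of_int n)) +
     left_value f * (\<Sum>\<^sub>\<infinity>n\<in>{..<0::int}. \<phi> (t - of_int n))"

definition left_gibbs_up :: "(real \<Rightarrow> real) \<Rightarrow> (real \<Rightarrow> real) \<Rightarrow> bool" where
  "left_gibbs_up \<phi> f \<longleftrightarrow>
     left_value f < right_value f \<and> (\<exists>y<0. gibbs_fun \<phi> f y < left_value f)"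

definition right_gibbs_up :: "(real \<Rightarrow> real) \<Rightarrow> (real \<Rightarrow> real) \<Rightarrow> bool" where
  "right_gibbs_up \<phi> f \<longleftrightarrow>
     left_value f < right_value f \<and> (\<exists>x>0. gibbs_fun \<phi> f x > right_value f)"

text \<open>The two disjuncts are mutually exclusive; for admissible \<open>f\<close> with a downward jump, \<open>- f\<close> is
  admissible with an upward jump.\<close>

definition left_gibbs_for :: "(real \<Rightarrow> real) \<Rightarrow> (real \<Rightarrow> real) \<Rightarrow> bool" where
  "left_gibbs_for \<phi> f \<longleftrightarrow>
     left_gibbs_up \<phi> f \<or> (left_value f > right_value f \<and> left_gibbs_up \<phi> (\<lambda>x. - f x))"

definition right_gibbs_for :: "(real \<Rightarrow> real) \<Rightarrow> (real \<Rightarrow> real) \<Rightarrow> bool" where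
  "right_gibbs_for \<phi> f \<longleftrightarrow>
     right_gibbs_up \<phi> f \<or> (left_value f > right_value f \<and> right_gibbs_up \<phi> (\<lambda>x. - f x))"

definition strong_gibbs_for :: "(real \<Rightarrow> real) \<Rightarrow> (real \<Rightarrow> real) \<Rightarrow> bool" where
  "strong_gibbs_for \<phi> f \<longleftrightarrow> left_gibbs_for \<phi> f \<and> right_gibbs_for \<phi> f"

definition left_gibbs :: "(real \<Rightarrow> real) \<Rightarrow> bool" where
  "left_gibbs \<phi> \<longleftrightarrow> (\<forall>f. admissible f \<longrightarrow> left_gibbs_for \<phi> f)"

definition right_gibbs :: "(real \<Rightarrow> real) \<Rightarrow> bool" where
  "right_gibbs \<phi> \<longleftrightarrow> (\<forall>f. admissible f \<longrightarrow> right_gibbs_for \<phi> f)"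

definition strong_gibbs :: "(real \<Rightarrow> real) \<Rightarrow> bool" where
  "strong_gibbs \<phi> \<longleftrightarrow> (\<forall>f. admissible f \<longrightarrow> strong_gibbs_for \<phi> f)"

end

theory Submission
  imports Defs
begin

text \<open>With $P(t) = \sum_{n \ge 0} \phi(t-n)$ and $Q(t) = \sum_{n < 0} \phi(t-n)$, absolute convergence
  and $1$-periodicity of the full sum give $P + Q = 1$ on the whole line. Hence
  $G_\phi[f] - f(0-) = (f(0+) - f(0-)) P$ and $G_\phi[f] - f(0+) = -(f(0+) - f(0-)) Q$, so the sign of
  the overshoot depends on $\phi$ and on the direction of the jump only.\<close>

text \<open>Reindexing by an integer translation. The kernel hypotheses concern only points of the
  unit interval; this carries them from \<open>frac t\<close> to an arbitrary real
  \<open>t\<close>.\<close>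

lemma has_sum_shift_int:
  fixes \<phi> :: "real \<Rightarrow> real" and k :: int
  shows "((\<lambda>n::int. \<phi> (t + of_int k - of_int n)) has_sum s) UNIV \<longleftrightarrow>
    ((\<lambda>n::int. \<phi> (t - of_int n)) has_sum s) UNIV"
  by (rule has_sum_reindex_bij_witness[of _ "\<lambda>n. n + k" "\<lambda>n. n - k"])
    (auto simp: algebra_simps)

text \<open>Pointwise convergence of the symmetric sums of absolute values bounds all finite sums of
  absolute values, which gives unordered summability at \<open>frac t\<close>; an integer shift then
  reaches \<open>t\<close>.\<close>

lemma generalized_sampling_kernel_summable:
  assumes "generalized_sampling_kernel \<phi>"
  shows "(\<lambda>n::int. \<phi> (t - of_int n)) summable_on UNIV"
proof -
  define u where "u = frac t"
  have u: "u \<in> {0..1}"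
    unfolding u_def using frac_lt_1[of t] by simp
  obtain l where l: "uniform_limit {0..1} (\<lambda>N t. \<Sum>n\<in>{- int N..int N}. \<bar>\<phi> (t - of_int n)\<bar>) l sequentially"
    using assms unfolding generalized_sampling_kernel_def uniformly_convergent_on_def by blast
  have lim: "(\<lambda>N. \<Sum>n\<in>{- int N..int N}. \<bar>\<phi> (u - of_int n)\<bar>) \<longlonglongrightarrow> l u"
    using tendsto_uniform_limitI[OF l u] .
  have inc: "incseq (\<lambda>N. \<Sum>n\<in>{- int N..int N}. \<bar>\<phi> (u - of_int n)\<bar>)"
    by (intro incseq_SucI sum_mono2) auto
  \<comment> \<open>A finite set of integers fits into a symmetric interval, and the increasing
    symmetric sums never exceed their limit.\<close>
  have bound: "(\<Sum>n\<in>F. \<bar>\<phi> (u - of_int n)\<bar>) \<le> l u" if "finite F" for F :: "int set"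
  proof -
    \<comment> \<open>For empty \<open>F\<close> this maximum is unspecified, but the bound on the
      elements of \<open>F\<close> is then vacuous.\<close>
    define M where "M = Max (abs ` F)"
    have M: "\<forall>n\<in>F. \<bar>n\<bar> \<le> M"
      using that by (simp add: M_def)
    have "F \<subseteq> {- int (nat M)..int (nat M)}"
      using M by force
    then have "(\<Sum>n\<in>F. \<bar>\<phi> (u - of_int n)\<bar>) \<le> (\<Sum>n\<in>{- int (nat M)..int (nat M)}. \<bar>\<phi> (u - of_int n)\<bar>)"
      by (intro sum_mono2) auto
    also have "\<dots> \<le> l u"
      using incseq_le[OF inc lim] .
    finally show ?thesis .
  qed
  have "(\<lambda>n::int. \<bar>\<phi> (u - of_int n)\<bar>) summable_on UNIV"
    by (rule nonneg_bdd_above_summable_on) (auto intro!: bdd_aboveI2 bound)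
  then have "(\<lambda>n::int. \<phi> (u - of_int n)) summable_on UNIV"
    by - (rule abs_summable_summable, simp)
  then obtain s where "((\<lambda>n::int. \<phi> (u - of_int n)) has_sum s) UNIV"
    unfolding summable_on_def by (elim exE)
  then have "((\<lambda>n::int. \<phi> (u + of_int \<lfloor>t\<rfloor> - of_int n)) has_sum s) UNIV"
    unfolding has_sum_shift_int[of \<phi> u "\<lfloor>t\<rfloor>"] .
  moreover have "u + of_int \<lfloor>t\<rfloor> = t"
    by (simp add: u_def frac_def)
  ultimately show ?thesis
    by (metis has_sum_imp_summable)
qed

lemma kernel_half_sums:
  assumes "generalized_sampling_kernel \<phi>"
    and "\<forall>t\<in>{0..<1}. (\<Sum>\<^sub>\<infinity>n\<in>(UNIV::int set). \<phi> (t - of_int n)) = 1"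
  shows "(\<Sum>\<^sub>\<infinity>n\<in>{0::int..}. \<phi> (t - of_int n)) + (\<Sum>\<^sub>\<infinity>n\<in>{..<0::int}. \<phi> (t - of_int n)) = 1"
proof -
  note summable = generalized_sampling_kernel_summable[OF assms(1)]
  have "(\<Sum>\<^sub>\<infinity>n\<in>(UNIV::int set). \<phi> (frac t - of_int n)) = 1"
    using assms(2) frac_lt_1[of t] by simp
  \<comment> \<open>Summability turns the value of the infinite sum into a \<open>has_sum\<close>
    statement, the form to which the shift applies.\<close>
  then have "((\<lambda>n::int. \<phi> (frac t - of_int n)) has_sum 1) UNIV"
    using has_sum_infsum[OF summable[of "frac t"]] by simp
  then have "((\<lambda>n::int. \<phi> (frac t + of_int \<lfloor>t\<rfloor> - of_int n)) has_sum 1) UNIV"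
    unfolding has_sum_shift_int[of \<phi> "frac t" "\<lfloor>t\<rfloor>"] .
  then have "(\<Sum>\<^sub>\<infinity>n\<in>(UNIV::int set). \<phi> (t - of_int n)) = 1"
    by (simp add: frac_def infsumI)
  moreover have "(\<Sum>\<^sub>\<infinity>n\<in>{0::int..} \<union> {..<0}. \<phi> (t - of_int n)) =
      (\<Sum>\<^sub>\<infinity>n\<in>{0::int..}. \<phi> (t - of_int n)) + (\<Sum>\<^sub>\<infinity>n\<in>{..<0::int}. \<phi> (t - of_int n))"
    by (intro infsum_Un_disjoint summable_on_subset_banach[OF summable]) auto
  moreover have "{0::int..} \<union> {..<0} = UNIV"
    by auto
  ultimately show ?thesis
    by simp
qed

text \<open>Eliminating one half sum by means of the other leaves an affine expression in a single
  half sum. The first form is suited to comparison with the left limit, the second to comparison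
  with the right limit.\<close>

lemma gibbs_fun_eq:
  assumes "generalized_sampling_kernel \<phi>"
    and "\<forall>t\<in>{0..<1}. (\<Sum>\<^sub>\<infinity>n\<in>(UNIV::int set). \<phi> (t - of_int n)) = 1"
  shows "gibbs_fun \<phi> f t =
      left_value f + (right_value f - left_value f) * (\<Sum>\<^sub>\<infinity>n\<in>{0::int..}. \<phi> (t - of_int n))"
    and "gibbs_fun \<phi> f t =
      right_value f - (right_value f - left_value f) * (\<Sum>\<^sub>\<infinity>n\<in>{..<0::int}. \<phi> (t - of_int n))"
proof -
  define P where "P = (\<Sum>\<^sub>\<infinity>n\<in>{0::int..}. \<phi> (t - of_int n))"
  have Q: "(\<Sum>\<^sub>\<infinity>n\<in>{..<0::int}. \<phi> (t - of_int n)) = 1 - P"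
    using kernel_half_sums[OF assms, of t] by (simp add: P_def)
  show "gibbs_fun \<phi> f t =
      left_value f + (right_value f - left_value f) * (\<Sum>\<^sub>\<infinity>n\<in>{0::int..}. \<phi> (t - of_int n))"
    unfolding gibbs_fun_def Q P_def[symmetric] by (simp add: algebra_simps)
  show "gibbs_fun \<phi> f t =
      right_value f - (right_value f - left_value f) * (\<Sum>\<^sub>\<infinity>n\<in>{..<0::int}. \<phi> (t - of_int n))"
    unfolding gibbs_fun_def Q P_def[symmetric] by (simp add: algebra_simps)
qed

text \<open>For an upward jump the half sum is multiplied by a positive number, so its sign alone
  decides whether there is an undershoot.\<close>

lemma left_gibbs_up_iff:
  assumes "generalized_sampling_kernel \<phi>"
    and "\<forall>t\<in>{0..<1}. (\<Sum>\<^sub>\<infinity>n\<in>(UNIV::int set). \<phi> (t - of_int n)) = 1"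
  shows "left_gibbs_up \<phi> f \<longleftrightarrow>
    left_value f < right_value f \<and> (\<exists>y<0. (\<Sum>\<^sub>\<infinity>n\<in>{0::int..}. \<phi> (y - of_int n)) < 0)"
  unfolding left_gibbs_up_def gibbs_fun_eq(1)[OF assms]
  by (auto simp: mult_less_0_iff)

lemma right_gibbs_up_iff:
  assumes "generalized_sampling_kernel \<phi>"
    and "\<forall>t\<in>{0..<1}. (\<Sum>\<^sub>\<infinity>n\<in>(UNIV::int set). \<phi> (t - of_int n)) = 1"
  shows "right_gibbs_up \<phi> f \<longleftrightarrow>
    left_value f < right_value f \<and> (\<exists>x>0. (\<Sum>\<^sub>\<infinity>n\<in>{..<0::int}. \<phi> (x - of_int n)) < 0)"
  unfolding right_gibbs_up_def gibbs_fun_eq(2)[OF assms]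
  by (auto simp: mult_less_0_iff)

lemma left_value_eqI: "(f \<longlongrightarrow> l) (at_left 0) \<Longrightarrow> left_value f = l"
  unfolding left_value_def by (simp add: tendsto_Lim)

lemma right_value_eqI: "(f \<longlongrightarrow> r) (at_right 0) \<Longrightarrow> right_value f = r"
  unfolding right_value_def by (simp add: tendsto_Lim)

text \<open>\<open>Lim\<close> is a definite description, so the existence of both one-sided limits,
  part of admissibility, is what lets negation pass through it.\<close>

lemma one_sided_values_minus:
  assumes "admissible f"
  shows "left_value (\<lambda>x. - f x) = - left_value f" "right_value (\<lambda>x. - f x) = - right_value f"
proof -
  obtain l r where "(f \<longlongrightarrow> l) (at_left 0)" "(f \<longlongrightarrow> r) (at_right 0)"
    using assms unfolding admissible_def by blast
  then show "left_value (\<lambda>x. - f x) = - left_value f" "right_value (\<lambda>x. - f x) = - right_value f"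
    by (simp_all add: left_value_eqI right_value_eqI tendsto_minus)
qed

text \<open>The jump is nonzero, hence upward for either \<open>f\<close> or its negative, and the
  resulting criterion does not mention the function.\<close>

lemma left_gibbs_for_iff:
  assumes "generalized_sampling_kernel \<phi>"
    and "\<forall>t\<in>{0..<1}. (\<Sum>\<^sub>\<infinity>n\<in>(UNIV::int set). \<phi> (t - of_int n)) = 1"
    and "admissible f"
  shows "left_gibbs_for \<phi> f \<longleftrightarrow> (\<exists>y<0. (\<Sum>\<^sub>\<infinity>n\<in>{0::int..}. \<phi> (y - of_int n)) < 0)"
  using assms(3) unfolding left_gibbs_for_def left_gibbs_up_iff[OF assms(1,2)]
    one_sided_values_minus[OF assms(3)]
  by (auto simp: admissible_def)

lemma right_gibbs_for_iff:
  assumes "generalized_sampling_kernel \<phi>"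
    and "\<forall>t\<in>{0..<1}. (\<Sum>\<^sub>\<infinity>n\<in>(UNIV::int set). \<phi> (t - of_int n)) = 1"
    and "admissible f"
  shows "right_gibbs_for \<phi> f \<longleftrightarrow> (\<exists>x>0. (\<Sum>\<^sub>\<infinity>n\<in>{..<0::int}. \<phi> (x - of_int n)) < 0)"
  using assms(3) unfolding right_gibbs_for_def right_gibbs_up_iff[OF assms(1,2)]
    one_sided_values_minus[OF assms(3)]
  by (auto simp: admissible_def)

text \<open>A witness that admissible functions exist. The half-line is closed at 0 so that the
  value there agrees with the right limit.\<close>

lemma admissible_indicator: "admissible (indicator {0..})"
proof -
  let ?f = "indicator {0..} :: real \<Rightarrow> real"
  have l: "(?f \<longlongrightarrow> 0) (at_left 0)"
    by (rule tendsto_eventually) (auto simp: eventually_at_filter indicator_def)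
  have r: "(?f \<longlongrightarrow> 1) (at_right 0)"
    by (rule tendsto_eventually) (auto simp: eventually_at_filter indicator_def)
  have "bounded (range ?f)"
    by (rule boundedI[of _ 1]) (auto simp: indicator_def)
  then show ?thesis
    unfolding admissible_def left_value_eqI[OF l] right_value_eqI[OF r] using l r by auto
qed

theorem theorem4:
  fixes \<phi> :: "real \<Rightarrow> real"
  assumes "generalized_sampling_kernel \<phi>"
    and "\<forall>t\<in>{0..<1}. (\<Sum>\<^sub>\<infinity>n\<in>(UNIV::int set). \<phi> (t - of_int n)) = 1"
  shows "(left_gibbs \<phi> \<longleftrightarrow> (\<exists>y<0. (\<Sum>\<^sub>\<infinity>n\<in>{0::int..}. \<phi> (y - of_int n)) < 0)) \<and>
    (right_gibbs \<phi> \<longleftrightarrow> (\<exists>x>0. (\<Sum>\<^sub>\<infinity>n\<in>{..<0::int}. \<phi> (x - of_int n)) < 0)) \<and>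
    (strong_gibbs \<phi> \<longleftrightarrow>
      (\<exists>y<0. \<exists>x>0. (\<Sum>\<^sub>\<infinity>n\<in>{0::int..}. \<phi> (y - of_int n)) < 0 \<and>
                   (\<Sum>\<^sub>\<infinity>n\<in>{..<0::int}. \<phi> (x - of_int n)) < 0))"
proof -
  let ?P = "\<exists>y<0. (\<Sum>\<^sub>\<infinity>n\<in>{0::int..}. \<phi> (y - of_int n)) < 0"
  let ?Q = "\<exists>x>0. (\<Sum>\<^sub>\<infinity>n\<in>{..<0::int}. \<phi> (x - of_int n)) < 0"
  have all_iff: "(\<forall>f. admissible f \<longrightarrow> R f) \<longleftrightarrow> S"
    if "\<And>f. admissible f \<Longrightarrow> R f \<longleftrightarrow> S" for R S
    using that admissible_indicator by blast
  have "left_gibbs \<phi> \<longleftrightarrow> ?P"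
    unfolding left_gibbs_def by (rule all_iff) (rule left_gibbs_for_iff[OF assms])
  moreover have "right_gibbs \<phi> \<longleftrightarrow> ?Q"
    unfolding right_gibbs_def by (rule all_iff) (rule right_gibbs_for_iff[OF assms])
  moreover have "strong_gibbs \<phi> \<longleftrightarrow> left_gibbs \<phi> \<and> right_gibbs \<phi>"
    unfolding strong_gibbs_def strong_gibbs_for_def left_gibbs_def right_gibbs_def by blast
  ultimately show ?thesis
    by blast
qed

end
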